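(* Let $p>0$, $q\ge 0$, and let $\mu=\frac{1}{\pi}\sqrt{\frac{q}{p}}$. If a kernel $k\in C^0([0,1])$ achieves Input-to-State Stabilization with gain $\frac{\gamma}{p\pi^2+q}\ge 0$ of the system $$u_t(t,x)=p\,u_{xx}(t,x)-q\,u(t,x)+v(t,x)\ (t>0,\ x\in(0,1)),\qquad u(t,0)=0,\quad u(t,1)=U(t)\ (t>0),$$ then $$\gamma\ge\sup_{m=1,2,\ldots}\sqrt{g_m(\mu)},$$ where, for every integer $m\ge 1$, $$g_m(0):=\max\left\{\sum_{n=1}^m\frac{v_n^2}{n^4}-\frac{6}{\pi^2}\left(\sum_{n=1}^m\frac{(-1)^nv_n}{n^3}\right)^2:\ (v_1,\ldots,v_m)\in\mathbb{R}^m,\ \sum_{n=1}^mv_n^2=1\right\}$$ and, for $\mu>0$, $$g_m(\mu):=\max\left\{\sum_{n=1}^mv_n^2\left(\frac{1+\mu^2}{n^2+\mu^2}\right)^2-\frac{8}{\pi^2}\left(\frac{\mu\pi\sinh^2(\mu\pi)}{\sinh(2\mu\pi)-2\mu\pi}\right)\left(\sum_{n=1}^m\frac{(-1)^n(1+\mu^2)\,n\,v_n}{(n^2+\mu^2)^2}\right)^2:\ (v_1,\ldots,v_m)\in\mathbb{R}^m,\ \sum_{n=1}^mv_n^2=1\right\}.$$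
   Context: Notation: $\mathbb{R}_+=[0,+\infty)$; $\|\cdot\|$ is the norm of $L^2(0,1)$, $\|g\|=\left(\int_0^1|g(x)|^2dx\right)^{1/2}$; for $u:\mathbb{R}_+\times[0,1]\to\mathbb{R}$, $u[t]$ denotes the profile $(u[t])(x)=u(t,x)$; $C^0(\mathbb{R}_+;L^2(0,1))$ is the class of functions for which $t\mapsto u[t]\in L^2(0,1)$ is continuous. Definition (Input-to-State Stabilization). Consider $u_t=p u_{xx}-q u+v$ for $t>0$, $x\in(0,1)$, with $u(t,0)=0$, $u(t,1)=U(t)$ for $t>0$, where $v:\mathbb{R}_+\times[0,1]\to\mathbb{R}$ is a distributed input (with $v[t]\in L^2(0,1)$) and $U$ is the control input. A kernel $k\in C^0([0,1])$ achieves Input-to-State Stabilization with gain $g\ge 0$ of this system if there exist constants $G,\sigma>0$ such that (for every distributed input $v$) every solution $u\in C^0(\mathbb{R}_+;L^2(0,1))\cap C^1((0,+\infty)\times[0,1])$ with $u[t]\in C^2([0,1])$ for $t>0$ of the closed-loop system with $U(t)=\int_0^1k(x)u(t,x)\,dx$ for $t>0$ satisfies $$\|u[t]\|\le G\exp(-\sigma t)\|u[0]\|+g\sup_{0\le s\le t}\|v[s]\|\quad\text{for all }t\ge 0.$$ *)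

theory Defs
  imports "HOL-Analysis.Analysis"
begin

text \<open>
  Functions \<open>u\<close> and \<open>v\<close> of time and space are curried: \<open>u t\<close> is the profile \<open>u[t]\<close>.  Their values
  outside \<open>t \<ge> 0\<close>, \<open>x \<in> [0,1]\<close> play no role.
\<close>

definition in_L2 :: "(real \<Rightarrow> real) \<Rightarrow> bool" where
  "in_L2 f \<longleftrightarrow> f \<in> borel_measurable (lebesgue_on {0<..<1})
     \<and> integrable (lebesgue_on {0<..<1}) (\<lambda>x. \<bar>f x\<bar>\<^sup>2)"

definition L2_norm :: "(real \<Rightarrow> real) \<Rightarrow> real" where
  "L2_norm f = sqrt (LINT x|lebesgue_on {0<..<1}. \<bar>f x\<bar>\<^sup>2)"

definition L2_continuous :: "(real \<Rightarrow> real \<Rightarrow> real) \<Rightarrow> bool" where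
  "L2_continuous u \<longleftrightarrow> (\<forall>t\<ge>0. in_L2 (u t))
     \<and> (\<forall>t\<ge>0. ((\<lambda>s. L2_norm (\<lambda>x. u s x - u t x)) \<longlongrightarrow> 0) (at t within {0..}))"

text \<open>
  Class \<open>C\<^sup>1((0,\<infinity>) \<times> [0,1])\<close>: both partial derivatives exist and are jointly continuous; the one in
  \<open>x\<close> is one-sided at \<open>x = 0\<close> and \<open>x = 1\<close>.
\<close>

definition C1_strip :: "(real \<Rightarrow> real \<Rightarrow> real) \<Rightarrow> bool" where
  "C1_strip u \<longleftrightarrow> (\<exists>ut ux.
     (\<forall>t>0. \<forall>x\<in>{0..1}. ((\<lambda>s. u s x) has_real_derivative ut t x) (at t)
                     \<and> (u t has_real_derivative ux t x) (at x within {0..1}))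
     \<and> continuous_on ({0<..} \<times> {0..1}) (\<lambda>(t, x). ut t x)
     \<and> continuous_on ({0<..} \<times> {0..1}) (\<lambda>(t, x). ux t x))"

definition C2_unit :: "(real \<Rightarrow> real) \<Rightarrow> bool" where
  "C2_unit f \<longleftrightarrow> (\<exists>f' f''.
     (\<forall>x\<in>{0..1}. (f has_real_derivative f' x) (at x within {0..1})
               \<and> (f' has_real_derivative f'' x) (at x within {0..1}))
     \<and> continuous_on {0..1} f'')"

definition is_solution ::
  "real \<Rightarrow> real \<Rightarrow> (real \<Rightarrow> real \<Rightarrow> real) \<Rightarrow> (real \<Rightarrow> real) \<Rightarrow> (real \<Rightarrow> real \<Rightarrow> real) \<Rightarrow> bool" where
  "is_solution p q v U u \<longleftrightarrow>
     L2_continuous u \<and> C1_strip u \<and> (\<forall>t>0. C2_unit (u t))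
     \<and> (\<forall>t>0. \<forall>x\<in>{0<..<1}.
          deriv (\<lambda>s. u s x) t = p * deriv (deriv (u t)) x - q * u t x + v t x)
     \<and> (\<forall>t>0. u t 0 = 0 \<and> u t 1 = U t)"

definition feedback :: "(real \<Rightarrow> real) \<Rightarrow> (real \<Rightarrow> real \<Rightarrow> real) \<Rightarrow> real \<Rightarrow> real" where
  "feedback k u t = (LINT x|lebesgue_on {0..1}. k x * u t x)"

text \<open>
  If \<open>\<parallel>v[s]\<parallel>\<close> is unbounded over \<open>0 \<le> s \<le> t\<close>, the supremum in the estimate is \<open>+\<infinity>\<close> and the
  estimate at \<open>t\<close> is void.  Since the real-valued \<open>SUP\<close> is meaningful for bounded families only,
  this is expressed by the premise \<open>bdd_above\<close>.
\<close>

definition achieves_ISS :: "real \<Rightarrow> real \<Rightarrow> (real \<Rightarrow> real) \<Rightarrow> real \<Rightarrow> bool" where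
  "achieves_ISS p q k g \<longleftrightarrow>
     (\<exists>G \<sigma>. G > 0 \<and> \<sigma> > 0 \<and>
       (\<forall>v u. (\<forall>t\<ge>0. in_L2 (v t)) \<longrightarrow> is_solution p q v (feedback k u) u \<longrightarrow>
         (\<forall>t\<ge>0. bdd_above ((\<lambda>s. L2_norm (v s)) ` {0..t}) \<longrightarrow>
            L2_norm (u t) \<le> G * exp (- \<sigma> * t) * L2_norm (u 0)
                            + g * (SUP s\<in>{0..t}. L2_norm (v s)))))"

text \<open>
  Vectors of \<open>\<real>\<^sup>m\<close> are functions on \<open>nat\<close> of which only the entries \<open>1, \<dots>, m\<close> are used.
\<close>

definition unit_vectors :: "nat \<Rightarrow> (nat \<Rightarrow> real) set" where
  "unit_vectors m = {w. (\<Sum>n=1..m. (w n)\<^sup>2) = 1}"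

definition gain_form :: "nat \<Rightarrow> real \<Rightarrow> (nat \<Rightarrow> real) \<Rightarrow> real" where
  "gain_form m \<mu> w =
     (if \<mu> = 0 then
        (\<Sum>n=1..m. (w n)\<^sup>2 / real n ^ 4)
        - 6 / pi\<^sup>2 * (\<Sum>n=1..m. (-1) ^ n * w n / real n ^ 3)\<^sup>2
      else
        (\<Sum>n=1..m. (w n)\<^sup>2 * ((1 + \<mu>\<^sup>2) / ((real n)\<^sup>2 + \<mu>\<^sup>2))\<^sup>2)
        - 8 / pi\<^sup>2 * (\<mu> * pi * (sinh (\<mu> * pi))\<^sup>2 / (sinh (2 * \<mu> * pi) - 2 * \<mu> * pi))
          * (\<Sum>n=1..m. (-1) ^ n * (1 + \<mu>\<^sup>2) * real n * w n / ((real n)\<^sup>2 + \<mu>\<^sup>2)\<^sup>2)\<^sup>2)"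

definition g_fun :: "nat \<Rightarrow> real \<Rightarrow> real" where
  "g_fun m \<mu> = (SUP w\<in>unit_vectors m. gain_form m \<mu> w)"

text \<open>The supremum in the definition of \<^const>\<open>g_fun\<close> is a maximum.\<close>

lemma g_fun_max:
  assumes "m \<ge> 1"
  obtains w where "w \<in> unit_vectors m" "gain_form m \<mu> w = g_fun m \<mu>"
    "\<And>w'. w' \<in> unit_vectors m \<Longrightarrow> gain_form m \<mu> w' \<le> g_fun m \<mu>"
proof -
  define B :: "(nat \<Rightarrow> real) set" where "B = (\<Pi>\<^sub>E i\<in>UNIV. if i \<in> {1..m} then {-1..1} else {0})"
  define K where "K = B \<inter> unit_vectors m"
  have "compactin (product_topology (\<lambda>_. euclidean) UNIV) B"
    unfolding B_def by (subst compactin_PiE) auto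
  then have "compact B"
    by (simp add: euclidean_product_topology)
  moreover have "closed (unit_vectors m)"
    unfolding unit_vectors_def by (intro closed_Collect_eq continuous_intros) auto
  ultimately have "compact K"
    unfolding K_def by (rule compact_Int_closed)
  have coord: "continuous_on K (\<lambda>w. w n)" for n :: nat
    by (rule continuous_on_subset[OF continuous_on_product_coordinates]) simp
  have cont: "continuous_on K (gain_form m \<mu>)"
  proof (cases "\<mu> = 0")
    case True
    then have "gain_form m \<mu> = (\<lambda>w. (\<Sum>n=1..m. (w n)\<^sup>2 * (1 / real n ^ 4))
        - 6 / pi\<^sup>2 * (\<Sum>n=1..m. (-1) ^ n * w n * (1 / real n ^ 3))\<^sup>2)"
      by (auto simp: gain_form_def)
    then show ?thesis
      by (simp only:) (intro continuous_intros coord)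
  next
    case False
    then have "gain_form m \<mu> = (\<lambda>w. (\<Sum>n=1..m. (w n)\<^sup>2 * ((1 + \<mu>\<^sup>2) / ((real n)\<^sup>2 + \<mu>\<^sup>2))\<^sup>2)
        - 8 / pi\<^sup>2 * (\<mu> * pi * (sinh (\<mu> * pi))\<^sup>2 / (sinh (2 * \<mu> * pi) - 2 * \<mu> * pi))
          * (\<Sum>n=1..m. (-1) ^ n * (1 + \<mu>\<^sup>2) * real n * w n * (1 / ((real n)\<^sup>2 + \<mu>\<^sup>2)\<^sup>2))\<^sup>2)"
      by (auto simp: gain_form_def)
    moreover have "continuous_on K \<dots>"
      by (intro continuous_intros coord)
    ultimately show ?thesis by simp
  qed
  have proj: "\<exists>w''\<in>K. gain_form m \<mu> w'' = gain_form m \<mu> w'" if "w' \<in> unit_vectors m" for w'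
  proof
    let ?w = "\<lambda>i. if i \<in> {1..m} then w' i else 0"
    show "gain_form m \<mu> ?w = gain_form m \<mu> w'"
      by (simp add: gain_form_def cong: sum.cong_simp)
    have "\<bar>w' i\<bar> \<le> 1" if "i \<in> {1..m}" for i
    proof -
      have "(w' i)\<^sup>2 \<le> (\<Sum>n=1..m. (w' n)\<^sup>2)"
        by (rule member_le_sum[of i "{1..m}" "\<lambda>n. (w' n)\<^sup>2"]) (use that in auto)
      then show ?thesis
        using \<open>w' \<in> unit_vectors m\<close> by (simp add: unit_vectors_def abs_square_le_1)
    qed
    then have "?w \<in> B"
      by (auto simp: B_def PiE_iff abs_le_iff minus_le_iff)
    moreover have "?w \<in> unit_vectors m"
      using that by (simp add: unit_vectors_def cong: sum.cong_simp)
    ultimately show "?w \<in> K"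
      by (simp add: K_def)
  qed
  have "(\<Sum>n=1..m. (if n = 1 then 1 else 0 :: real)\<^sup>2) = (\<Sum>n=1..m. if n = 1 then 1 else 0)"
    by (rule sum.cong) auto
  then have "(\<lambda>n. if n = 1 then 1 else 0) \<in> unit_vectors m"
    using assms by (simp add: unit_vectors_def)
  then have "K \<noteq> {}"
    using proj by blast
  from continuous_attains_sup[OF \<open>compact K\<close> this cont]
  obtain w where w: "w \<in> K" "\<And>w'. w' \<in> K \<Longrightarrow> gain_form m \<mu> w' \<le> gain_form m \<mu> w"
    by blast
  have max: "gain_form m \<mu> w' \<le> gain_form m \<mu> w" if "w' \<in> unit_vectors m" for w'
    using proj[OF that] w(2) by force
  have wu: "w \<in> unit_vectors m"
    using w(1) by (simp add: K_def)
  have "g_fun m \<mu> = gain_form m \<mu> w"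
    unfolding g_fun_def by (rule cSup_eq_maximum) (use wu max in auto)
  with wu max show thesis
    by (intro that[of w]) auto
qed

end

theory Submission
  imports Defs
begin

text \<open>
  Every lower bound on the gain comes from a single stationary solution.  If a time-independent
  \<open>f\<close> satisfies \<open>f 0 = 0\<close> and \<open>f 1 = \<integral> k f\<close>, then it solves the closed loop with the constant
  input \<open>q f - p f''\<close>; letting \<open>t \<rightarrow> \<infinity>\<close> in the stability estimate removes the term that depends
  on the initial state and leaves \<open>\<parallel>f\<parallel> \<le> g \<parallel>q f - p f''\<parallel>\<close> (lemma \<open>ISS_equilibrium_bound\<close>).

  Let \<open>e\<^sub>n(x) = \<surd>2 sin(n \<pi> x)\<close>.  The input \<open>(p\<pi>\<^sup>2 + q) \<Sum> w\<^sub>n e\<^sub>n\<close> with unit vector \<open>w\<close> has norm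
  \<open>p\<pi>\<^sup>2 + q\<close>, and the stationary equation \<open>q f - p f'' = (p\<pi>\<^sup>2 + q) \<Sum> w\<^sub>n e\<^sub>n\<close>, \<open>f 0 = 0\<close> has the
  solutions \<open>\<phi> + c s\<close>, where \<open>\<phi> = \<Sum> a\<^sub>n e\<^sub>n\<close> with \<open>a\<^sub>n = w\<^sub>n (1 + \<mu>\<^sup>2) / (n\<^sup>2 + \<mu>\<^sup>2)\<close> and \<open>s\<close> is the
  homogeneous solution vanishing at \<open>0\<close>, that is \<open>s x = x\<close> or \<open>s x = sinh (\<mu> \<pi> x)\<close>.  The feedback
  law fixes \<open>c\<close>, since \<open>s 1 \<noteq> \<integral> k s\<close>: otherwise \<open>s\<close> would be a nonzero equilibrium without input,
  which contradicts stability.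

  The value of \<open>c\<close> depends on the kernel, but whatever it is, \<open>\<parallel>\<phi> + c s\<parallel>\<close> is at least the distance
  of \<open>\<phi>\<close> to the line spanned by \<open>s\<close>, so
  \<open>\<gamma>\<^sup>2 \<ge> \<parallel>\<phi> + c s\<parallel>\<^sup>2 \<ge> \<parallel>\<phi>\<parallel>\<^sup>2 - \<langle>\<phi>, s\<rangle>\<^sup>2 / \<parallel>s\<parallel>\<^sup>2\<close>.
  As the \<open>e\<^sub>n\<close> are orthonormal and \<open>\<langle>e\<^sub>n, s\<rangle>\<close> is given by Green's identity, the right-hand side is
  the quadratic form in \<open>w\<close> whose maximum is \<open>g\<^sub>m(\<mu>)\<close>.
\<close>

section \<open>Integrals and square norms on the unit interval\<close>

lemma continuous_in_L2:
  assumes "continuous_on {0..1} f"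
  shows "in_L2 f"
    and "L2_norm f = sqrt (integral {0..1} (\<lambda>x. (f x)\<^sup>2))"
proof -
  have int: "integrable (lebesgue_on {0<..<1}) (\<lambda>x. (f x)\<^sup>2)"
  proof -
    have "(\<lambda>x. (f x)\<^sup>2) absolutely_integrable_on {0..1}"
      using absolutely_integrable_continuous_real[of 0 1 "\<lambda>x. (f x)\<^sup>2"] assms
      by (auto intro: continuous_intros)
    then have "(\<lambda>x. (f x)\<^sup>2) absolutely_integrable_on {0<..<1}"
      by (rule set_integrable_subset) auto
    then show ?thesis
      by (rule absolutely_integrable_imp_integrable) auto
  qed
  moreover have "f \<in> borel_measurable (lebesgue_on {0<..<1})"
    using assms by (intro continuous_imp_measurable_on_sets_lebesgue)
      (auto elim: continuous_on_subset)
  ultimately show "in_L2 f"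
    by (simp add: in_L2_def)
  show "L2_norm f = sqrt (integral {0..1} (\<lambda>x. (f x)\<^sup>2))"
    unfolding L2_norm_def
    using lebesgue_integral_eq_integral[OF int] by (simp add: integral_open_interval_real)
qed

lemma has_integral_deriv_unit_interval:
  fixes F f :: "real \<Rightarrow> real"
  assumes "\<And>x. (F has_real_derivative f x) (at x)"
  shows "(f has_integral F 1 - F 0) {0..1}"
  using assms
  by (intro fundamental_theorem_of_calculus)
    (auto simp: has_real_derivative_iff_has_vector_derivative[symmetric]
          intro: has_field_derivative_at_within)

lemma integrable_continuous_mult:
  fixes f g :: "real \<Rightarrow> real"
  assumes "continuous_on {0..1} f" and "continuous_on {0..1} g"
  shows "(\<lambda>x. f x * g x) integrable_on {0..1}"
  by (rule integrable_continuous_real) (intro continuous_intros assms)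

text \<open>
  The right-hand side is the squared distance of \<open>\<phi>\<close> to the line spanned by \<open>s\<close>, which is attained
  at \<open>c = - \<langle>\<phi>, s\<rangle> / \<parallel>s\<parallel>\<^sup>2\<close>.
\<close>

lemma square_integral_ge_distance_to_line:
  fixes \<phi> s :: "real \<Rightarrow> real"
  assumes \<phi>: "continuous_on {0..1} \<phi>" and s: "continuous_on {0..1} s"
    and pos: "integral {0..1} (\<lambda>x. (s x)\<^sup>2) > 0"
  shows "integral {0..1} (\<lambda>x. (\<phi> x)\<^sup>2)
           - (integral {0..1} (\<lambda>x. \<phi> x * s x))\<^sup>2 / integral {0..1} (\<lambda>x. (s x)\<^sup>2)
         \<le> integral {0..1} (\<lambda>x. (\<phi> x + c * s x)\<^sup>2)"
proof -
  define P where "P = integral {0..1} (\<lambda>x. (\<phi> x)\<^sup>2)"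
  define B where "B = integral {0..1} (\<lambda>x. \<phi> x * s x)"
  define N where "N = integral {0..1} (\<lambda>x. (s x)\<^sup>2)"
  have P: "((\<lambda>x. (\<phi> x)\<^sup>2) has_integral P) {0..1}"
    unfolding P_def power2_eq_square by (intro integrable_integral integrable_continuous_mult \<phi>)
  have B: "((\<lambda>x. \<phi> x * s x) has_integral B) {0..1}"
    unfolding B_def by (intro integrable_integral integrable_continuous_mult \<phi> s)
  have N: "((\<lambda>x. (s x)\<^sup>2) has_integral N) {0..1}"
    unfolding N_def power2_eq_square by (intro integrable_integral integrable_continuous_mult s)
  have "((\<lambda>x. (\<phi> x)\<^sup>2 + 2 * c * (\<phi> x * s x) + c\<^sup>2 * (s x)\<^sup>2)
          has_integral P + 2 * c * B + c\<^sup>2 * N) {0..1}"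
    by (intro has_integral_add has_integral_mult_right P B N)
  moreover have "(\<lambda>x. (\<phi> x)\<^sup>2 + 2 * c * (\<phi> x * s x) + c\<^sup>2 * (s x)\<^sup>2)
      = (\<lambda>x. (\<phi> x + c * s x)\<^sup>2)"
    by (auto simp: power2_eq_square algebra_simps)
  ultimately have "integral {0..1} (\<lambda>x. (\<phi> x + c * s x)\<^sup>2) = P + 2 * c * B + c\<^sup>2 * N"
    by (simp add: integral_unique)
  moreover have "N > 0"
    using pos by (simp add: N_def)
  then have "P + 2 * c * B + c\<^sup>2 * N - (P - B\<^sup>2 / N) = (c * N + B)\<^sup>2 / N"
    by (simp add: field_simps power2_eq_square)
  then have "P - B\<^sup>2 / N \<le> P + 2 * c * B + c\<^sup>2 * N"
    using \<open>N > 0\<close> by (smt (verit) divide_nonneg_pos zero_le_power2)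
  ultimately show ?thesis
    by (simp add: P_def B_def N_def)
qed

section \<open>Stationary solutions of the closed loop\<close>

lemma feedback_stationary:
  assumes "continuous_on {0..1} k" and "continuous_on {0..1} f"
  shows "feedback k (\<lambda>t. f) t = integral {0..1} (\<lambda>x. k x * f x)"
  unfolding feedback_def
  by (intro lebesgue_integral_eq_integral continuous_imp_integrable_real continuous_intros assms)
    auto

text \<open>
  A profile \<open>f\<close> that satisfies both boundary conditions is an equilibrium for the constant input
  \<open>q f - p f''\<close>; the stability estimate then holds at all times with \<open>f\<close> on both sides, and only
  the gain term survives in the limit \<open>t \<rightarrow> \<infinity>\<close>.
\<close>

lemma ISS_equilibrium_bound:
  fixes f f' f'' :: "real \<Rightarrow> real"
  assumes iss: "achieves_ISS p q k g" and k: "continuous_on {0..1} k"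
    and d1: "\<And>x. (f has_real_derivative f' x) (at x)"
    and d2: "\<And>x. (f' has_real_derivative f'' x) (at x)"
    and c2: "continuous_on UNIV f''"
    and b0: "f 0 = 0" and b1: "f 1 = integral {0..1} (\<lambda>x. k x * f x)"
  shows "L2_norm f \<le> g * L2_norm (\<lambda>x. q * f x - p * f'' x)"
proof -
  define v where "v = (\<lambda>x. q * f x - p * f'' x)"
  have cf: "continuous_on A f" and cf': "continuous_on A f'" and cf'': "continuous_on A f''" for A
    using d1 d2 c2
    by (auto intro: DERIV_isCont continuous_at_imp_continuous_on continuous_on_subset)
  have cv: "continuous_on {0..1} v"
    unfolding v_def by (intro continuous_intros cf cf'')
  have deriv: "deriv f = f'" "deriv f' = f''"
    using d1 d2 by (auto intro: DERIV_imp_deriv)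
  have "L2_continuous (\<lambda>t. f)"
    unfolding L2_continuous_def using continuous_in_L2[OF cf] by (simp add: L2_norm_def)
  moreover have "C1_strip (\<lambda>t. f)"
    unfolding C1_strip_def
  proof (intro exI conjI allI ballI impI)
    fix t x :: real
    show "((\<lambda>s. f x) has_real_derivative (\<lambda>t x. 0) t x) (at t)"
      by simp
    show "(f has_real_derivative (\<lambda>t. f') t x) (at x within {0..1})"
      using d1 by (rule has_field_derivative_at_within)
    show "continuous_on ({0<..} \<times> {0..1}) (\<lambda>(t::real, x::real). (0::real))"
      by (simp add: case_prod_unfold)
    show "continuous_on ({0<..} \<times> {0..1}) (\<lambda>(t::real, x). f' x)"
      unfolding case_prod_unfold by (intro continuous_on_compose2[OF cf'[of UNIV]] continuous_intros) auto
  qed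
  moreover have "C2_unit f"
    unfolding C2_unit_def using d1 d2 cf'' by (blast intro: has_field_derivative_at_within)
  ultimately have sol: "is_solution p q (\<lambda>t. v) (feedback k (\<lambda>t. f)) (\<lambda>t. f)"
    using b0 b1
    by (auto simp: is_solution_def deriv v_def feedback_stationary[OF k cf])
  obtain G \<sigma> where "\<sigma> > 0" and est: "\<forall>v u. (\<forall>t\<ge>0. in_L2 (v t)) \<longrightarrow> is_solution p q v (feedback k u) u \<longrightarrow>
      (\<forall>t\<ge>0. bdd_above ((\<lambda>s. L2_norm (v s)) ` {0..t}) \<longrightarrow>
        L2_norm (u t) \<le> G * exp (- \<sigma> * t) * L2_norm (u 0) + g * (SUP s\<in>{0..t}. L2_norm (v s)))"
    using iss unfolding achieves_ISS_def by (elim exE conjE)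
  have "L2_norm f \<le> G * exp (- \<sigma> * t) * L2_norm f + g * L2_norm v" if "t \<ge> 0" for t
  proof -
    have "(\<lambda>s::real. L2_norm v) ` {0..t} = {L2_norm v}"
      using that by auto
    then show ?thesis
      using est[rule_format, OF _ sol that] continuous_in_L2(1)[OF cv] by simp
  qed
  then have "\<forall>\<^sub>F t in at_top. L2_norm f \<le> G * exp (- \<sigma> * t) * L2_norm f + g * L2_norm v"
    by (auto intro: eventually_at_top_linorderI[of 0])
  moreover have "((\<lambda>t. G * exp (- \<sigma> * t) * L2_norm f + g * L2_norm v)
      \<longlongrightarrow> G * 0 * L2_norm f + g * L2_norm v) at_top"
  proof -
    have "filterlim (\<lambda>t. - \<sigma> * t) at_bot at_top"
      using \<open>\<sigma> > 0\<close> by (intro filterlim_tendsto_neg_mult_at_bot[OF tendsto_const] filterlim_ident) auto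
    then show ?thesis
      by (intro tendsto_intros filterlim_compose[OF exp_at_bot])
  qed
  ultimately have "L2_norm f \<le> G * 0 * L2_norm f + g * L2_norm v"
    by (intro tendsto_lowerbound) auto
  then show ?thesis
    by (simp add: v_def)
qed

text \<open>
  The boundary value problem of the closed loop is uniquely solvable: a nonzero solution of the
  homogeneous problem would be an equilibrium that does not decay.
\<close>

lemma ISS_homogeneous_boundary_defect:
  fixes s s' :: "real \<Rightarrow> real"
  assumes iss: "achieves_ISS p q k g" and k: "continuous_on {0..1} k"
    and d1: "\<And>x. (s has_real_derivative s' x) (at x)"
    and d2: "\<And>x. (s' has_real_derivative a * s x) (at x)"
    and a: "q = p * a" and s0: "s 0 = 0"
    and pos: "integral {0..1} (\<lambda>x. (s x)\<^sup>2) > 0"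
  shows "s 1 \<noteq> integral {0..1} (\<lambda>x. k x * s x)"
proof
  assume s1: "s 1 = integral {0..1} (\<lambda>x. k x * s x)"
  have cs: "continuous_on A s" for A
    using d1 by (auto intro: DERIV_isCont continuous_at_imp_continuous_on)
  have "L2_norm s \<le> g * L2_norm (\<lambda>x. q * s x - p * (a * s x))"
    by (rule ISS_equilibrium_bound[OF iss k d1 d2 _ s0 s1]) (intro continuous_intros cs)
  also have "\<dots> = 0"
    by (simp add: a L2_norm_def)
  finally show False
    using pos by (simp add: continuous_in_L2(2)[OF cs])
qed

section \<open>Sine modes\<close>

definition sine_mode :: "nat \<Rightarrow> real \<Rightarrow> real" where
  "sine_mode n x = sqrt 2 * sin (n * pi * x)"

definition sine_mode' :: "nat \<Rightarrow> real \<Rightarrow> real" where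
  "sine_mode' n x = sqrt 2 * (n * pi) * cos (n * pi * x)"

lemma sine_mode_derivs:
  "(sine_mode n has_real_derivative sine_mode' n x) (at x)"
  "(sine_mode' n has_real_derivative - (n * pi)\<^sup>2 * sine_mode n x) (at x)"
  unfolding sine_mode_def [abs_def] sine_mode'_def [abs_def]
  by (auto intro!: derivative_eq_intros simp: power2_eq_square)

lemma sine_mode_boundary:
  "sine_mode n 0 = 0" "sine_mode n 1 = 0" "sine_mode' n 1 = sqrt 2 * (n * pi) * (-1) ^ n"
  by (simp_all add: sine_mode_def sine_mode'_def cos_npi)

lemma continuous_sine_mode: "continuous_on A (sine_mode n)"
  using sine_mode_derivs(1) by (auto intro: DERIV_isCont continuous_at_imp_continuous_on)

text \<open>
  Green's identity for two eigenfunctions: the integrand is the derivative of \<open>f' h - f h'\<close>.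
\<close>

lemma has_integral_eigenfunction_product:
  fixes f f' h h' :: "real \<Rightarrow> real"
  assumes f: "\<And>x. (f has_real_derivative f' x) (at x)"
    "\<And>x. (f' has_real_derivative a * f x) (at x)"
    and h: "\<And>x. (h has_real_derivative h' x) (at x)"
    "\<And>x. (h' has_real_derivative b * h x) (at x)"
    and "a \<noteq> b"
  shows "((\<lambda>x. f x * h x) has_integral
           ((f' 1 * h 1 - f 1 * h' 1) - (f' 0 * h 0 - f 0 * h' 0)) / (a - b)) {0..1}"
proof -
  have "((\<lambda>x. f' x * h x - f x * h' x) has_real_derivative (a - b) * (f x * h x)) (at x)" for x
    by (auto intro!: derivative_eq_intros f h simp: algebra_simps)
  then have "((\<lambda>x. (a - b) * (f x * h x)) has_integral
      (f' 1 * h 1 - f 1 * h' 1) - (f' 0 * h 0 - f 0 * h' 0)) {0..1}"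
    by (rule has_integral_deriv_unit_interval)
  from has_integral_divide[OF this, of "a - b"] show ?thesis
    using \<open>a \<noteq> b\<close> by simp
qed

text \<open>
  Distinct modes belong to distinct eigenvalues, so Green's identity makes them orthogonal; for
  \<open>n = m\<close> the eigenvalues coincide, and an explicit antiderivative takes its place.
\<close>

lemma sine_mode_orthonormal:
  assumes "n \<ge> 1" and "m \<ge> 1"
  shows "((\<lambda>x. sine_mode n x * sine_mode m x) has_integral (if n = m then 1 else 0)) {0..1}"
proof (cases "n = m")
  case True
  let ?F = "\<lambda>x. x - sin (2 * (m * pi) * x) / (2 * (m * pi))"
  have "(?F has_real_derivative sine_mode n x * sine_mode m x) (at x)" for x
  proof -
    have "cos (2 * (m * pi) * x) = 1 - 2 * (sin (m * pi * x))\<^sup>2"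
      using cos_double_sin[of "m * pi * x"] by (simp add: mult.assoc)
    then show ?thesis
      using True \<open>m \<ge> 1\<close>
      by (auto intro!: derivative_eq_intros simp: sine_mode_def power2_eq_square)
  qed
  then have "((\<lambda>x. sine_mode n x * sine_mode m x) has_integral ?F 1 - ?F 0) {0..1}"
    by (rule has_integral_deriv_unit_interval)
  moreover have "sin (2 * (m * pi)) = 0"
    using sin_npi[of "2 * m"] by (simp add: mult.assoc)
  ultimately show ?thesis
    using True by simp
next
  case False
  then have "- (n * pi)\<^sup>2 \<noteq> - (m * pi)\<^sup>2"
    by simp
  from has_integral_eigenfunction_product[OF sine_mode_derivs sine_mode_derivs this] show ?thesis
    using False by (simp add: sine_mode_boundary)
qed

lemma integral_square_sine_sum:
  "integral {0..1} (\<lambda>x. (\<Sum>n=1..m. a n * sine_mode n x)\<^sup>2) = (\<Sum>n=1..m. (a n)\<^sup>2)"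
proof -
  have "((\<lambda>x. \<Sum>i=1..m. \<Sum>j=1..m. (a i * a j) * (sine_mode i x * sine_mode j x)) has_integral
      (\<Sum>i=1..m. \<Sum>j=1..m. (a i * a j) * (if i = j then 1 else 0))) {0..1}"
    by (intro has_integral_sum has_integral_mult_right sine_mode_orthonormal) auto
  moreover have "(\<Sum>j=1..m. (a i * a j) * (if i = j then 1 else 0)) = (a i)\<^sup>2" if "i \<in> {1..m}" for i
    using that by (simp add: if_distrib sum.delta power2_eq_square cong: if_cong)
  moreover have "(\<Sum>i=1..m. \<Sum>j=1..m. (a i * a j) * (sine_mode i x * sine_mode j x))
      = (\<Sum>n=1..m. a n * sine_mode n x)\<^sup>2" for x
    by (simp add: power2_eq_square sum_product mult_ac)
  ultimately show ?thesis
    by (simp add: integral_unique)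
qed

text \<open>
  Only the boundary term \<open>sine_mode' n 1 * s 1\<close> of Green's identity survives, so the homogeneous
  solution enters through its value at \<open>1\<close> alone.
\<close>

lemma has_integral_sine_mode_homogeneous:
  assumes s: "\<And>x. (s has_real_derivative s' x) (at x)"
    "\<And>x. (s' has_real_derivative (\<mu> * pi)\<^sup>2 * s x) (at x)"
    and "s 0 = 0" and "n \<ge> 1"
  shows "((\<lambda>x. sine_mode n x * s x) has_integral
           - (sqrt 2 * s 1 / pi) * ((-1) ^ n * real n / ((real n)\<^sup>2 + \<mu>\<^sup>2))) {0..1}"
proof -
  have pos: "(real n)\<^sup>2 + \<mu>\<^sup>2 > 0"
    using \<open>n \<ge> 1\<close> by (simp add: add_pos_nonneg)
  have diff: "- (n * pi)\<^sup>2 - (\<mu> * pi)\<^sup>2 = - (((real n)\<^sup>2 + \<mu>\<^sup>2) * pi\<^sup>2)"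
    by (simp add: power_mult_distrib algebra_simps)
  have "((real n)\<^sup>2 + \<mu>\<^sup>2) * pi\<^sup>2 > 0"
    using pos by simp
  with diff have "- (n * pi)\<^sup>2 \<noteq> (\<mu> * pi)\<^sup>2"
    by linarith
  note has_integral_eigenfunction_product[OF sine_mode_derivs s this]
  moreover have "((sine_mode' n 1 * s 1 - sine_mode n 1 * s' 1)
        - (sine_mode' n 0 * s 0 - sine_mode n 0 * s' 0)) / (- (n * pi)\<^sup>2 - (\<mu> * pi)\<^sup>2)
      = - (sqrt 2 * s 1 / pi) * ((-1) ^ n * real n / ((real n)\<^sup>2 + \<mu>\<^sup>2))"
    unfolding diff using pos by (simp add: sine_mode_boundary \<open>s 0 = 0\<close> power2_eq_square mult_ac)
  ultimately show ?thesis
    by simp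
qed

section \<open>The lower bound on the gain\<close>

text \<open>
  The bound for an arbitrary nonzero homogeneous solution \<open>s\<close>; it covers \<open>\<mu> = 0\<close> and \<open>\<mu> > 0\<close>
  at once, since \<open>s\<close> enters only through \<open>(s 1)\<^sup>2 / \<parallel>s\<parallel>\<^sup>2\<close>.
\<close>

lemma ISS_gain_lower_bound:
  fixes s s' :: "real \<Rightarrow> real"
  assumes p: "p > 0" and q: "q = p * (\<mu> * pi)\<^sup>2" and k: "continuous_on {0..1} k"
    and \<gamma>: "\<gamma> \<ge> 0" and iss: "achieves_ISS p q k (\<gamma> / (p * pi\<^sup>2 + q))"
    and s1: "\<And>x. (s has_real_derivative s' x) (at x)"
    and s2: "\<And>x. (s' has_real_derivative (\<mu> * pi)\<^sup>2 * s x) (at x)"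
    and s0: "s 0 = 0" and s_pos: "integral {0..1} (\<lambda>x. (s x)\<^sup>2) > 0"
    and w: "w \<in> unit_vectors m"
  shows "(\<Sum>n=1..m. (w n)\<^sup>2 * ((1 + \<mu>\<^sup>2) / ((real n)\<^sup>2 + \<mu>\<^sup>2))\<^sup>2)
         - 2 / pi\<^sup>2 * ((s 1)\<^sup>2 / integral {0..1} (\<lambda>x. (s x)\<^sup>2))
           * (\<Sum>n=1..m. (-1) ^ n * (1 + \<mu>\<^sup>2) * real n * w n / ((real n)\<^sup>2 + \<mu>\<^sup>2)\<^sup>2)\<^sup>2
         \<le> \<gamma>\<^sup>2"
proof -
  \<comment> \<open>The coefficients of the response to the forcing \<open>K \<Sum> w\<^sub>n e\<^sub>n\<close>, where \<open>K = p\<pi>\<^sup>2 + q\<close>.\<close>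
  define a where "a n = w n * ((1 + \<mu>\<^sup>2) / ((real n)\<^sup>2 + \<mu>\<^sup>2))" for n
  define \<phi> where "\<phi> x = (\<Sum>n=1..m. a n * sine_mode n x)" for x
  define \<phi>' where "\<phi>' x = (\<Sum>n=1..m. a n * sine_mode' n x)" for x
  define \<phi>'' where "\<phi>'' x = (\<Sum>n=1..m. a n * (- (n * pi)\<^sup>2 * sine_mode n x))" for x
  define K where "K = p * pi\<^sup>2 + q"
  have K: "K > 0" "K = p * pi\<^sup>2 * (1 + \<mu>\<^sup>2)"
    using p by (auto simp: K_def q add_pos_nonneg power_mult_distrib algebra_simps)
  have \<phi>1: "(\<phi> has_real_derivative \<phi>' x) (at x)"
    and \<phi>2: "(\<phi>' has_real_derivative \<phi>'' x) (at x)" for x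
    unfolding \<phi>_def [abs_def] \<phi>'_def [abs_def] \<phi>''_def
    by (intro DERIV_sum DERIV_cmult sine_mode_derivs)+
  have c\<phi>: "continuous_on A \<phi>" and c\<phi>'': "continuous_on A \<phi>''" for A
    unfolding \<phi>_def [abs_def] \<phi>''_def [abs_def] by (intro continuous_intros continuous_sine_mode)+
  have cs: "continuous_on A s" for A
    using s1 by (auto intro: DERIV_isCont continuous_at_imp_continuous_on)
  \<comment> \<open>The coefficient for which \<open>\<phi> + c s\<close> obeys the feedback law, in view of \<open>\<phi> 1 = 0\<close>.\<close>
  define c where "c = integral {0..1} (\<lambda>x. k x * \<phi> x) / (s 1 - integral {0..1} (\<lambda>x. k x * s x))"
  define f where "f x = \<phi> x + c * s x" for x
  have "f 1 = integral {0..1} (\<lambda>x. k x * f x)"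
  proof -
    have "integral {0..1} (\<lambda>x. k x * f x)
        = integral {0..1} (\<lambda>x. k x * \<phi> x + c * (k x * s x))"
      by (simp add: f_def algebra_simps)
    also have "\<dots> = integral {0..1} (\<lambda>x. k x * \<phi> x) + c * integral {0..1} (\<lambda>x. k x * s x)"
      using integrable_continuous_mult[OF k c\<phi>] integrable_continuous_mult[OF k cs]
      by (subst integral_add) (auto intro: integrable_on_mult_right)
    also have "\<dots> = c * s 1"
      using ISS_homogeneous_boundary_defect[OF iss k s1 s2 q s0 s_pos]
      by (simp add: c_def field_simps)
    also have "\<dots> = f 1"
      by (simp add: f_def \<phi>_def sine_mode_boundary)
    finally show ?thesis ..
  qed
  moreover have "f 0 = 0"
    by (simp add: f_def \<phi>_def sine_mode_boundary s0)
  moreover have "(f has_real_derivative \<phi>' x + c * s' x) (at x)"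
    and "((\<lambda>x. \<phi>' x + c * s' x) has_real_derivative \<phi>'' x + c * ((\<mu> * pi)\<^sup>2 * s x)) (at x)" for x
    unfolding f_def [abs_def] by (intro DERIV_add DERIV_cmult \<phi>1 \<phi>2 s1 s2)+
  moreover have "continuous_on UNIV (\<lambda>x. \<phi>'' x + c * ((\<mu> * pi)\<^sup>2 * s x))"
    by (intro continuous_intros c\<phi>'' cs)
  ultimately have bound:
    "L2_norm f \<le> \<gamma> / K * L2_norm (\<lambda>x. q * f x - p * (\<phi>'' x + c * ((\<mu> * pi)\<^sup>2 * s x)))"
    using ISS_equilibrium_bound[OF iss k, of f "\<lambda>x. \<phi>' x + c * s' x"] by (simp add: K_def)
  have a_eigen: "a n * (q + p * (n * pi)\<^sup>2) = K * w n" if "n \<in> {1..m}" for n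
  proof -
    have "(real n)\<^sup>2 + \<mu>\<^sup>2 \<noteq> 0"
      using that by (simp add: sum_power2_eq_zero_iff)
    moreover have "q + p * (n * pi)\<^sup>2 = p * pi\<^sup>2 * ((real n)\<^sup>2 + \<mu>\<^sup>2)"
      by (simp add: q power_mult_distrib algebra_simps)
    ultimately show ?thesis
      by (simp only: a_def K(2)) (simp add: field_simps)
  qed
  \<comment> \<open>The multiple of \<open>s\<close> does not contribute to the forcing.\<close>
  have "q * f x - p * (\<phi>'' x + c * ((\<mu> * pi)\<^sup>2 * s x)) = (\<Sum>n=1..m. (K * w n) * sine_mode n x)" for x
  proof -
    have "q * f x - p * (\<phi>'' x + c * ((\<mu> * pi)\<^sup>2 * s x)) = q * \<phi> x - p * \<phi>'' x"
      by (simp add: f_def q algebra_simps)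
    also have "\<dots> = (\<Sum>n=1..m. a n * (q + p * (n * pi)\<^sup>2) * sine_mode n x)"
      unfolding \<phi>_def \<phi>''_def sum_distrib_left sum_subtractf[symmetric]
      by (intro sum.cong refl) (simp add: algebra_simps)
    finally show ?thesis
      using a_eigen by simp
  qed
  then have "L2_norm (\<lambda>x. q * f x - p * (\<phi>'' x + c * ((\<mu> * pi)\<^sup>2 * s x)))
      = L2_norm (\<lambda>x. \<Sum>n=1..m. (K * w n) * sine_mode n x)"
    by simp
  also have "\<dots> = sqrt (\<Sum>n=1..m. (K * w n)\<^sup>2)"
    by (subst continuous_in_L2(2))
      (auto intro!: continuous_intros continuous_sine_mode simp only: integral_square_sine_sum)
  also have "\<dots> = K"
    using w K(1) by (simp add: power_mult_distrib sum_distrib_left[symmetric] unit_vectors_def)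
  finally have "L2_norm f \<le> \<gamma>"
    using bound K(1) by simp
  moreover have "L2_norm f = sqrt (integral {0..1} (\<lambda>x. (\<phi> x + c * s x)\<^sup>2))"
    unfolding f_def [abs_def] by (intro continuous_in_L2(2) continuous_intros c\<phi> cs)
  ultimately have upper: "integral {0..1} (\<lambda>x. (\<phi> x + c * s x)\<^sup>2) \<le> \<gamma>\<^sup>2"
    by (simp add: sqrt_le_D)
  have \<phi>_norm: "integral {0..1} (\<lambda>x. (\<phi> x)\<^sup>2)
      = (\<Sum>n=1..m. (w n)\<^sup>2 * ((1 + \<mu>\<^sup>2) / ((real n)\<^sup>2 + \<mu>\<^sup>2))\<^sup>2)"
    unfolding \<phi>_def integral_square_sine_sum by (simp only: a_def power_mult_distrib)
  have "((\<lambda>x. \<Sum>n=1..m. a n * (sine_mode n x * s x)) has_integral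
      (\<Sum>n=1..m. a n * (- (sqrt 2 * s 1 / pi) * ((-1) ^ n * real n / ((real n)\<^sup>2 + \<mu>\<^sup>2))))) {0..1}"
    by (intro has_integral_sum has_integral_mult_right
        has_integral_sine_mode_homogeneous[OF s1 s2 s0]) auto
  moreover have "(\<Sum>n=1..m. a n * (- (sqrt 2 * s 1 / pi) * ((-1) ^ n * real n / ((real n)\<^sup>2 + \<mu>\<^sup>2))))
      = - (sqrt 2 * s 1 / pi)
        * (\<Sum>n=1..m. (-1) ^ n * (1 + \<mu>\<^sup>2) * real n * w n / ((real n)\<^sup>2 + \<mu>\<^sup>2)\<^sup>2)"
    unfolding sum_distrib_left a_def by (intro sum.cong refl) (simp add: power2_eq_square mult_ac)
  ultimately have \<phi>_s: "integral {0..1} (\<lambda>x. \<phi> x * s x) = - (sqrt 2 * s 1 / pi)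
        * (\<Sum>n=1..m. (-1) ^ n * (1 + \<mu>\<^sup>2) * real n * w n / ((real n)\<^sup>2 + \<mu>\<^sup>2)\<^sup>2)"
    by (simp add: \<phi>_def sum_distrib_right mult.assoc integral_unique)
  show ?thesis
    using square_integral_ge_distance_to_line[OF c\<phi> cs s_pos, of c] upper
    unfolding \<phi>_norm \<phi>_s by (simp add: power_mult_distrib power_divide)
qed

lemma integral_square_sinh:
  fixes b :: real
  assumes "b \<noteq> 0"
  shows "integral {0..1} (\<lambda>x. (sinh (b * x))\<^sup>2) = (sinh (2 * b) - 2 * b) / (4 * b)"
proof -
  let ?F = "\<lambda>x. sinh (2 * (b * x)) / (4 * b) - x / 2"
  have "(?F has_real_derivative (sinh (b * x))\<^sup>2) (at x)" for x
    using assms cosh_double[of "b * x"] cosh_square_eq[of "b * x"]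
    by (auto intro!: derivative_eq_intros simp: field_simps)
  then have "((\<lambda>x. (sinh (b * x))\<^sup>2) has_integral ?F 1 - ?F 0) {0..1}"
    by (rule has_integral_deriv_unit_interval)
  then show ?thesis
    using assms by (simp add: integral_unique field_simps)
qed

lemma ISS_gain_form_le:
  assumes p: "p > 0" and \<mu>: "\<mu> \<ge> 0" and q: "q = p * (\<mu> * pi)\<^sup>2" and k: "continuous_on {0..1} k"
    and \<gamma>: "\<gamma> \<ge> 0" and iss: "achieves_ISS p q k (\<gamma> / (p * pi\<^sup>2 + q))"
    and w: "w \<in> unit_vectors m"
  shows "gain_form m \<mu> w \<le> \<gamma>\<^sup>2"
proof (cases "\<mu> = 0")
  case True
  have norm: "integral {0..1} (\<lambda>x::real. x\<^sup>2) = 1 / 3"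
  proof -
    have "((\<lambda>x. x ^ 3 / 3) has_real_derivative x\<^sup>2) (at x)" for x :: real
      by (auto intro!: derivative_eq_intros)
    then have "((\<lambda>x::real. x\<^sup>2) has_integral 1 ^ 3 / 3 - 0 ^ 3 / 3) {0..1}"
      by (rule has_integral_deriv_unit_interval)
    then show ?thesis
      by (simp add: integral_unique)
  qed
  have "(\<Sum>n=1..m. (w n)\<^sup>2 * ((1 + \<mu>\<^sup>2) / ((real n)\<^sup>2 + \<mu>\<^sup>2))\<^sup>2)
      - 2 / pi\<^sup>2 * (1\<^sup>2 / integral {0..1} (\<lambda>x::real. x\<^sup>2))
        * (\<Sum>n=1..m. (-1) ^ n * (1 + \<mu>\<^sup>2) * real n * w n / ((real n)\<^sup>2 + \<mu>\<^sup>2)\<^sup>2)\<^sup>2 \<le> \<gamma>\<^sup>2"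
    by (rule ISS_gain_lower_bound[OF p q k \<gamma> iss, of "\<lambda>x. x" "\<lambda>x. 1"])
      (use w True in \<open>auto simp: norm\<close>)
  moreover have "(\<Sum>n=1..m. (w n)\<^sup>2 * ((1 + \<mu>\<^sup>2) / ((real n)\<^sup>2 + \<mu>\<^sup>2))\<^sup>2)
      = (\<Sum>n=1..m. (w n)\<^sup>2 / real n ^ 4)"
    by (simp add: True power_divide flip: power_mult)
  moreover have "(\<Sum>n=1..m. (-1) ^ n * (1 + \<mu>\<^sup>2) * real n * w n / ((real n)\<^sup>2 + \<mu>\<^sup>2)\<^sup>2)
      = (\<Sum>n=1..m. (-1) ^ n * w n / real n ^ 3)"
    by (intro sum.cong refl) (simp add: True field_simps power2_eq_square power3_eq_cube)
  ultimately show ?thesis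
    using True by (simp add: gain_form_def norm)
next
  case False
  define b where "b = \<mu> * pi"
  have "b > 0"
    using False \<mu> by (simp add: b_def)
  let ?s = "\<lambda>x. sinh (b * x)" and ?s' = "\<lambda>x. b * cosh (b * x)"
  have norm: "integral {0..1} (\<lambda>x. (?s x)\<^sup>2) = (sinh (2 * b) - 2 * b) / (4 * b)"
    using \<open>b > 0\<close> by (simp add: integral_square_sinh)
  have "integral {0..1} (\<lambda>x. (?s x)\<^sup>2) > 0"
  proof -
    have "integral {0..1} (\<lambda>x. (?s x)\<^sup>2) \<ge> 0"
      by (intro integral_nonneg integrable_continuous_real continuous_intros) auto
    moreover have "integral {0..1} (\<lambda>x. (?s x)\<^sup>2) \<noteq> 0"
      using \<open>b > 0\<close> by (subst integral_eq_0_iff) (auto intro!: continuous_intros bexI[of _ 1])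
    ultimately show ?thesis
      by simp
  qed
  moreover have "(?s has_real_derivative ?s' x) (at x)"
    and "(?s' has_real_derivative b\<^sup>2 * ?s x) (at x)" for x
    by (auto intro!: derivative_eq_intros simp: power2_eq_square)
  ultimately have "(\<Sum>n=1..m. (w n)\<^sup>2 * ((1 + \<mu>\<^sup>2) / ((real n)\<^sup>2 + \<mu>\<^sup>2))\<^sup>2)
      - 2 / pi\<^sup>2 * ((?s 1)\<^sup>2 / integral {0..1} (\<lambda>x. (?s x)\<^sup>2))
        * (\<Sum>n=1..m. (-1) ^ n * (1 + \<mu>\<^sup>2) * real n * w n / ((real n)\<^sup>2 + \<mu>\<^sup>2)\<^sup>2)\<^sup>2 \<le> \<gamma>\<^sup>2"
    by (intro ISS_gain_lower_bound[OF p q k \<gamma> iss, of ?s ?s']) (auto simp: w b_def)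
  moreover have "2 / pi\<^sup>2 * ((?s 1)\<^sup>2 / integral {0..1} (\<lambda>x. (?s x)\<^sup>2))
      = 8 / pi\<^sup>2 * (\<mu> * pi * (sinh (\<mu> * pi))\<^sup>2 / (sinh (2 * \<mu> * pi) - 2 * \<mu> * pi))"
    unfolding norm by (simp add: b_def mult.assoc)
  ultimately show ?thesis
    using False by (simp only: gain_form_def if_False)
qed

theorem theorem3p3:
  fixes p q \<mu> \<gamma> :: real and k :: "real \<Rightarrow> real"
  assumes "p > 0" and "q \<ge> 0"
    and "\<mu> = 1 / pi * sqrt (q / p)"
    and "continuous_on {0..1} k"
    and "\<gamma> / (p * pi\<^sup>2 + q) \<ge> 0"
    and "achieves_ISS p q k (\<gamma> / (p * pi\<^sup>2 + q))"
  shows "ereal \<gamma> \<ge> (SUP m\<in>{1..}. ereal (sqrt (g_fun m \<mu>)))"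
proof (rule SUP_least)
  fix m :: nat
  assume "m \<in> {1..}"
  have "p * pi\<^sup>2 + q > 0"
    using assms(1,2) by (simp add: add_pos_nonneg)
  with assms(5) have \<gamma>: "\<gamma> \<ge> 0"
    by (simp add: zero_le_divide_iff)
  have \<mu>: "\<mu> \<ge> 0" and q: "q = p * (\<mu> * pi)\<^sup>2"
    using assms(1-3) by simp_all
  obtain w where w: "w \<in> unit_vectors m" "gain_form m \<mu> w = g_fun m \<mu>"
    using \<open>m \<in> {1..}\<close> by (metis atLeast_iff g_fun_max)
  have "g_fun m \<mu> \<le> \<gamma>\<^sup>2"
    using ISS_gain_form_le[OF assms(1) \<mu> q assms(4) \<gamma> assms(6) w(1)] w(2) by simp
  then show "ereal (sqrt (g_fun m \<mu>)) \<le> ereal \<gamma>"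
    using \<gamma> by (simp add: real_le_lsqrt)
qed

end
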